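(* Let $X$ and $Y$ be vector spaces with semi-norms $\|\cdot\|_X$ and $\|\cdot\|_Y$, let $C\subseteq X\cap Y$, and let $\{T_t\}_{t\ge0}$ be a semigroup of mappings $T_t:C\to C$. Suppose that there are $M,\gamma,\delta>0$ and $\hat\omega\in\mathbb{R}$ such that $$\|T_tu_0\|_X\le M e^{\hat\omega t}\frac{\|u_0\|_Y^{\gamma}}{t^{\delta}}\quad\text{for every }t>0\text{ and }u_0\in C,$$ and that there are $L\ge1$, $\omega\in\mathbb{R}$ such that $$\limsup_{h\to0+}\frac{\|T_{t+h}u_0-T_tu_0\|_X}{h}\le 2Le^{\omega t}\frac{\|u_0\|_X}{t}\quad\text{for every }t>0,\ u_0\in C.$$ Then for every $u_0\in C$ and $t>0$, $$\limsup_{h\to0+}\frac{\|T_{t+h}u_0-T_tu_0\|_X}{h}\le 2^{\delta+2}LM\,e^{\frac12(\omega+\hat\omega)t}\,\frac{\|u_0\|_Y^{\gamma}}{t^{\delta+1}}.$$ Moreover, if the right-hand derivative $\frac{d}{dt_+}T_tu_0$ exists in $X$ at $t>0$, then $$\left\|\frac{d}{dt_+}T_tu_0\right\|_X\le 2^{\delta+2}LM\,e^{\frac12(\omega+\hat\omega)t}\,\frac{\|u_0\|_Y^{\gamma}}{t^{\delta+1}}.$$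
   Context: A family $\{T_t\}_{t\ge0}$ of mappings $T_t:C\to C$ is called a semigroup if $T_{t+s}u=T_t(T_su)$ for all $t,s\ge0$ and $u\in C$. The right-hand derivative is $\frac{d}{dt_+}T_tu_0=\lim_{h\to0+}\frac{T_{t+h}u_0-T_tu_0}{h}$ in $X$. *)

theory Defs
  imports "HOL-Analysis.Analysis"
begin

definition seminorm_on :: "'v::real_vector set \<Rightarrow> ('v \<Rightarrow> real) \<Rightarrow> bool" where
  "seminorm_on X p \<longleftrightarrow>
     (\<forall>x\<in>X. 0 \<le> p x) \<and>
     (\<forall>x\<in>X. \<forall>a. p (a *\<^sub>R x) = \<bar>a\<bar> * p x) \<and>
     (\<forall>x\<in>X. \<forall>y\<in>X. p (x + y) \<le> p x + p y)"

(* No identity law at time 0 is required. *)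
definition semigroup_on :: "'v set \<Rightarrow> (real \<Rightarrow> 'v \<Rightarrow> 'v) \<Rightarrow> bool" where
  "semigroup_on C T \<longleftrightarrow>
     (\<forall>t\<ge>0. T t \<in> C \<rightarrow> C) \<and>
     (\<forall>t\<ge>0. \<forall>s\<ge>0. \<forall>u\<in>C. T (t + s) u = T t (T s u))"

(* A relation rather than a function: limits with respect to a seminorm need not be unique. *)
definition has_right_derivative_in ::
    "'v::real_vector set \<Rightarrow> ('v \<Rightarrow> real) \<Rightarrow> (real \<Rightarrow> 'v) \<Rightarrow> 'v \<Rightarrow> real \<Rightarrow> bool" where
  "has_right_derivative_in X p f v t \<longleftrightarrow>
     v \<in> X \<and> ((\<lambda>h. p ((1 / h) *\<^sub>R (f (t + h) - f t) - v)) \<longlongrightarrow> 0) (at_right 0)"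

end

theory Submission
  imports Defs
begin

text \<open>Halve the time. By the semigroup law, the orbit of \<open>u\<^sub>0\<close> near time
  \<open>t\<close> is the orbit near time \<open>t / 2\<close> of the point
  \<open>u\<^sub>1 = T (t / 2) u\<^sub>0\<close>, which again lies in \<open>C\<close>. The assumed
  Limsup estimate at time \<open>t / 2\<close> bounds the difference quotients by the
  \<open>X\<close>-seminorm of \<open>u\<^sub>1\<close>, and the regularization estimate over the
  first half bounds that seminorm by the \<open>Y\<close>-seminorm of \<open>u\<^sub>0\<close>.
  Multiplying the two bounds gives the claim. The bound passes to a right-hand derivative because
  the seminorm of a derivative never exceeds the Limsup of the seminorms of the quotients
  (\<open>right_derivative_le_Limsup\<close>).\<close>

lemma seminorm_on_minus:
  assumes "seminorm_on X p" and "x \<in> X"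
  shows "p (- x) = p x"
proof -
  have "p ((-1) *\<^sub>R x) = \<bar>-1\<bar> * p x"
    using assms unfolding seminorm_on_def by blast
  then show ?thesis by simp
qed

text \<open>The reverse triangle inequality bounds each quotient's seminorm below by
  \<open>p v\<close> minus an error that vanishes as \<open>h\<close> tends to 0. Values of
  \<open>f\<close> must lie in \<open>X\<close> from \<open>t\<close> on, since the seminorm laws
  hold only there.\<close>

lemma right_derivative_le_Limsup:
  assumes "subspace X" and p: "seminorm_on X p"
    and f: "\<And>s. s \<ge> t \<Longrightarrow> f s \<in> X"
    and der: "has_right_derivative_in X p f v t"
  shows "ereal (p v) \<le> Limsup (at_right 0) (\<lambda>h. ereal (p (f (t + h) - f t) / h))"
proof -
  define q where "q = (\<lambda>h. (1 / h) *\<^sub>R (f (t + h) - f t))"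
  have v: "v \<in> X" and lim: "((\<lambda>h. p (q h - v)) \<longlongrightarrow> 0) (at_right 0)"
    using der unfolding has_right_derivative_in_def q_def by auto
  have le: "p v - p (q h - v) \<le> p (f (t + h) - f t) / h" if "h > 0" for h
  proof -
    have d: "f (t + h) - f t \<in> X"
      using that by (intro subspace_diff assms f) auto
    then have "q h \<in> X"
      unfolding q_def by (intro subspace_scale assms)
    then have qv: "q h - v \<in> X" and nqv: "- (q h - v) \<in> X"
      using v by (auto intro!: subspace_diff subspace_neg assms)
    \<comment> \<open>The sum on the left is \<open>v\<close>, written as the quotient minus its
      error.\<close>
    have "p (q h + - (q h - v)) \<le> p (q h) + p (- (q h - v))"
      using p \<open>q h \<in> X\<close> nqv unfolding seminorm_on_def by blast
    then have "p v \<le> p (q h) + p (q h - v)"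
      using seminorm_on_minus[OF p qv] by simp
    moreover have "p (q h) = \<bar>1 / h\<bar> * p (f (t + h) - f t)"
      using p d unfolding q_def seminorm_on_def by blast
    ultimately show ?thesis using that by simp
  qed
  \<comment> \<open>The lower bound converges, so its Limsup is exactly \<open>p v\<close>, and
    monotonicity of Limsup finishes.\<close>
  have "((\<lambda>h. ereal (p v - p (q h - v))) \<longlongrightarrow> ereal (p v)) (at_right 0)"
    using tendsto_diff[OF tendsto_const lim, of "p v"] by simp
  then have "ereal (p v) = Limsup (at_right 0) (\<lambda>h. ereal (p v - p (q h - v)))"
    by (intro lim_imp_Limsup[symmetric]) auto
  also have "\<dots> \<le> Limsup (at_right 0) (\<lambda>h. ereal (p (f (t + h) - f t) / h))"
    by (intro Limsup_mono eventually_at_right_less[THEN eventually_mono])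
      (simp only: ereal_less_eq le)
  finally show ?thesis .
qed

theorem corollary2p6:
  fixes X Y C :: "'v::real_vector set"
    and norm_X norm_Y :: "'v \<Rightarrow> real"
    and T :: "real \<Rightarrow> 'v \<Rightarrow> 'v"
    and M \<gamma> \<delta> \<omega>' L \<omega> :: real
  assumes "subspace X" and "seminorm_on X norm_X"
    and "subspace Y" and "seminorm_on Y norm_Y"
    and "C \<subseteq> X \<inter> Y"
    and "semigroup_on C T"
    and "M > 0" and "\<gamma> > 0" and "\<delta> > 0"
    and "\<And>t u\<^sub>0. t > 0 \<Longrightarrow> u\<^sub>0 \<in> C \<Longrightarrow>
           norm_X (T t u\<^sub>0) \<le> M * exp (\<omega>' * t) * (norm_Y u\<^sub>0 powr \<gamma> / t powr \<delta>)"
    and "L \<ge> 1"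
    and "\<And>t u\<^sub>0. t > 0 \<Longrightarrow> u\<^sub>0 \<in> C \<Longrightarrow>
           Limsup (at_right 0) (\<lambda>h. ereal (norm_X (T (t + h) u\<^sub>0 - T t u\<^sub>0) / h))
             \<le> ereal (2 * L * exp (\<omega> * t) * (norm_X u\<^sub>0 / t))"
  shows "\<forall>u\<^sub>0\<in>C. \<forall>t>0.
           Limsup (at_right 0) (\<lambda>h. ereal (norm_X (T (t + h) u\<^sub>0 - T t u\<^sub>0) / h))
             \<le> ereal (2 powr (\<delta> + 2) * L * M * exp (1 / 2 * (\<omega> + \<omega>') * t)
                      * (norm_Y u\<^sub>0 powr \<gamma> / t powr (\<delta> + 1))) \<and>
           (\<forall>v. has_right_derivative_in X norm_X (\<lambda>s. T s u\<^sub>0) v t \<longrightarrow>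
                norm_X v \<le> 2 powr (\<delta> + 2) * L * M * exp (1 / 2 * (\<omega> + \<omega>') * t)
                      * (norm_Y u\<^sub>0 powr \<gamma> / t powr (\<delta> + 1)))"
proof (intro ballI allI impI)
  fix u\<^sub>0 and t :: real
  assume u: "u\<^sub>0 \<in> C" and t: "t > 0"
  let ?D = "\<lambda>h. ereal (norm_X (T (t + h) u\<^sub>0 - T t u\<^sub>0) / h)"
  let ?B = "2 powr (\<delta> + 2) * L * M * exp (1 / 2 * (\<omega> + \<omega>') * t)
              * (norm_Y u\<^sub>0 powr \<gamma> / t powr (\<delta> + 1))"
  define u\<^sub>1 where "u\<^sub>1 = T (t / 2) u\<^sub>0"
  have T_C: "T s u\<^sub>0 \<in> C" if "s \<ge> 0" for s
    using \<open>semigroup_on C T\<close> u that unfolding semigroup_on_def by blast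
  have u\<^sub>1: "u\<^sub>1 \<in> C"
    unfolding u\<^sub>1_def using t by (intro T_C) simp
  \<comment> \<open>The increment \<open>h\<close> goes into the outer map, so that
    \<open>u\<^sub>1\<close> does not depend on it.\<close>
  have split: "T (t + h) u\<^sub>0 = T (t / 2 + h) u\<^sub>1" if "h \<ge> 0" for h
  proof -
    have "0 \<le> t / 2 + h" and "0 \<le> t / 2"
      using that t by simp_all
    then have "T ((t / 2 + h) + t / 2) u\<^sub>0 = T (t / 2 + h) u\<^sub>1"
      using \<open>semigroup_on C T\<close> u unfolding semigroup_on_def u\<^sub>1_def by blast
    moreover have "(t / 2 + h) + t / 2 = t + h"
      by simp
    ultimately show ?thesis by simp
  qed
  \<comment> \<open>The case \<open>h = 0\<close> of \<open>split\<close> rewrites the subtracted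
    term \<open>T t u\<^sub>0\<close>; the other term is rewritten for \<open>h > 0\<close>, which
    is all a right-sided Limsup sees.\<close>
  have "Limsup (at_right 0) ?D =
      Limsup (at_right 0) (\<lambda>h. ereal (norm_X (T (t / 2 + h) u\<^sub>1 - T (t / 2) u\<^sub>1) / h))"
    using split[of 0]
    by (intro Limsup_eq eventually_at_right_less[THEN eventually_mono]) (simp add: split)
  also have "\<dots> \<le> ereal (2 * L * exp (\<omega> * (t / 2)) * (norm_X u\<^sub>1 / (t / 2)))"
    using assms(12)[of "t / 2" u\<^sub>1] t u\<^sub>1 by simp
  also have "\<dots> \<le> ereal ?B"
  proof -
    have "norm_X u\<^sub>1 \<le> M * exp (\<omega>' * (t / 2)) * (norm_Y u\<^sub>0 powr \<gamma> / (t / 2) powr \<delta>)"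
      unfolding u\<^sub>1_def by (rule assms(10)) (use t u in simp_all)
    then have "2 * L * exp (\<omega> * (t / 2)) * (norm_X u\<^sub>1 / (t / 2)) \<le>
        2 * L * exp (\<omega> * (t / 2)) *
          (M * exp (\<omega>' * (t / 2)) * (norm_Y u\<^sub>0 powr \<gamma> / (t / 2) powr \<delta>) / (t / 2))"
      using t \<open>L \<ge> 1\<close> by (intro mult_left_mono divide_right_mono) auto
    \<comment> \<open>Dividing by \<open>t / 2\<close> turns the factor 2 into 4, and the power of
      \<open>t / 2\<close> contributes \<open>2 powr \<delta>\<close>; together they make
      \<open>2 powr (\<delta> + 2)\<close>. The two half-time exponentials merge into the averaged
      rate.\<close>
    also have "\<dots> = ?B"
    proof -
      have "exp (1 / 2 * (\<omega> + \<omega>') * t) = exp (\<omega> * (t / 2)) * exp (\<omega>' * (t / 2))"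
        unfolding exp_add[symmetric] by (rule arg_cong[of _ _ exp]) (simp add: field_simps)
      moreover have "2 powr (\<delta> + 2) = 4 * 2 powr \<delta>"
        by (simp add: powr_add)
      moreover have "t powr (\<delta> + 1) = t powr \<delta> * t"
        using t by (simp add: powr_add)
      moreover have "(t / 2) powr \<delta> = t powr \<delta> / 2 powr \<delta>"
        using t by (simp add: powr_divide)
      ultimately show ?thesis by simp
    qed
    finally show ?thesis by simp
  qed
  finally have bound: "Limsup (at_right 0) ?D \<le> ereal ?B" .
  have "norm_X v \<le> ?B" if "has_right_derivative_in X norm_X (\<lambda>s. T s u\<^sub>0) v t" for v
  proof -
    have "T s u\<^sub>0 \<in> X" if "s \<ge> t" for s
      using T_C[of s] that t \<open>C \<subseteq> X \<inter> Y\<close> by auto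
    then have "ereal (norm_X v) \<le> Limsup (at_right 0) ?D"
      using assms(1,2) that
      by (intro right_derivative_le_Limsup[where X = X and f = "\<lambda>s. T s u\<^sub>0" and v = v])
    then show ?thesis
      using bound ereal_less_eq(3) order_trans by blast
  qed
  with bound show "Limsup (at_right 0) ?D \<le> ereal ?B \<and>
      (\<forall>v. has_right_derivative_in X norm_X (\<lambda>s. T s u\<^sub>0) v t \<longrightarrow> norm_X v \<le> ?B)"
    by blast
qed

end
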